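(* Let $p,q\ge 3$ be integers, $A=R_x^{2\pi/p}$, $B=R_z^{2\pi/q}$, and let $G(p,q)\subset SO(3)$ be the group generated by $A$ and $B$. Then $G(p,q)$ is isomorphic to the free product $\mathbb{Z}_p*\mathbb{Z}_q=\langle\alpha,\beta:\alpha^p,\ \beta^q\rangle$, with the isomorphism given by $\alpha\mapsto A$, $\beta\mapsto B$, if and only if both $p$ and $q$ are odd.
   Context: $R_x^{\theta}, R_z^{\theta}\in SO(3)$ denote the rotations of Euclidean 3-space by angle $\theta$ (right-hand rule) about the $x$- and $z$-axis respectively. *)

theory Defs
  imports
    "HOL-Algebra.Elementary_Groups"
    "HOL-Algebra.Generated_Groups"
    "HOL-Analysis.Analysis"
begin

section \<open>Group presentations\<close>

text \<open>
  A word over the generators \<open>'g\<close> is a list of letters \<open>(x, b)\<close>, where \<open>(x, True)\<close> stands for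
  \<open>x\<close> and \<open>(x, False)\<close> for the inverse of \<open>x\<close>.  The group presented by a set \<open>R\<close> of relators is
  the set of words modulo insertion and deletion of cancelling pairs and of relators.
\<close>

type_synonym 'g word = "('g \<times> bool) list"

inductive pres_eq :: "'g word set \<Rightarrow> 'g word \<Rightarrow> 'g word \<Rightarrow> bool" for R where
  refl: "pres_eq R u u"
| sym: "pres_eq R u v \<Longrightarrow> pres_eq R v u"
| trans: "pres_eq R u v \<Longrightarrow> pres_eq R v w \<Longrightarrow> pres_eq R u w"
| cancel: "pres_eq R (u @ [(x, b), (x, \<not> b)] @ v) (u @ v)"
| relator: "r \<in> R \<Longrightarrow> pres_eq R (u @ r @ v) (u @ v)"

definition word_class :: "'g word set \<Rightarrow> 'g word \<Rightarrow> 'g word set" where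
  "word_class R u = {v. pres_eq R u v}"

definition presented_group :: "'g word set \<Rightarrow> 'g word set monoid" where
  "presented_group R =
    \<lparr>carrier = range (word_class R),
     monoid.mult = (\<lambda>X Y. {w. \<exists>u\<in>X. \<exists>v\<in>Y. pres_eq R (u @ v) w}),
     one = word_class R []\<rparr>"

definition pres_gen :: "'g word set \<Rightarrow> 'g \<Rightarrow> 'g word set" where
  "pres_gen R x = word_class R [(x, True)]"

lemma word_class_eq_iff: "word_class R u = word_class R v \<longleftrightarrow> pres_eq R u v"
  unfolding word_class_def by (auto intro: pres_eq.intros)

lemma pres_eq_append_left: "pres_eq R u v \<Longrightarrow> pres_eq R (w @ u) (w @ v)"
proof (induction rule: pres_eq.induct)
  case (cancel u x b v)
  show ?case using pres_eq.cancel[of R "w @ u" x b v] by simp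
next
  case (relator r u v)
  then show ?case using pres_eq.relator[of r R "w @ u" v] by simp
qed (blast intro: pres_eq.intros)+

lemma pres_eq_append_right: "pres_eq R u v \<Longrightarrow> pres_eq R (u @ w) (v @ w)"
proof (induction rule: pres_eq.induct)
  case (cancel u x b v)
  show ?case using pres_eq.cancel[of R u x b "v @ w"] by simp
next
  case (relator r u v)
  then show ?case using pres_eq.relator[of r R u "v @ w"] by simp
qed (blast intro: pres_eq.intros)+

lemma pres_eq_append:
  "pres_eq R u u' \<Longrightarrow> pres_eq R v v' \<Longrightarrow> pres_eq R (u @ v) (u' @ v')"
  by (meson pres_eq.trans pres_eq_append_left pres_eq_append_right)

lemma mult_word_class [simp]:
  "word_class R u \<otimes>\<^bsub>presented_group R\<^esub> word_class R v = word_class R (u @ v)"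
  unfolding presented_group_def word_class_def
  by (auto intro: pres_eq.intros pres_eq_append)

lemma carrier_presented_group: "carrier (presented_group R) = range (word_class R)"
  by (simp add: presented_group_def)

lemma one_presented_group: "\<one>\<^bsub>presented_group R\<^esub> = word_class R []"
  by (simp add: presented_group_def)

lemma pres_eq_left_inverse: "\<exists>v. pres_eq R (v @ u) []"
proof (induction u)
  case Nil
  show ?case using pres_eq.refl[of R "[]"] by (metis append_Nil)
next
  case (Cons l u)
  obtain x b where l: "l = (x, b)" by fastforce
  from Cons obtain v where v: "pres_eq R (v @ u) []" by blast
  have "pres_eq R (v @ [(x, \<not> b), (x, \<not> \<not> b)] @ u) (v @ u)"
    by (rule pres_eq.cancel)
  then have "pres_eq R ((v @ [(x, \<not> b)]) @ l # u) []"
    using v l by (auto intro: pres_eq.trans)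
  then show ?case by blast
qed

lemma group_presented_group: "group (presented_group R)"
proof (rule groupI)
  fix X assume "X \<in> carrier (presented_group R)"
  then obtain u where u: "X = word_class R u"
    by (auto simp: carrier_presented_group)
  obtain v where "pres_eq R (v @ u) []"
    using pres_eq_left_inverse by blast
  then have "word_class R v \<otimes>\<^bsub>presented_group R\<^esub> X = \<one>\<^bsub>presented_group R\<^esub>"
    by (simp add: u one_presented_group word_class_eq_iff)
  then show "\<exists>Y\<in>carrier (presented_group R). Y \<otimes>\<^bsub>presented_group R\<^esub> X = \<one>\<^bsub>presented_group R\<^esub>"
    by (auto simp: carrier_presented_group)
qed (auto simp: carrier_presented_group one_presented_group)

lemma pres_gen_closed [simp]: "pres_gen R x \<in> carrier (presented_group R)"
  by (simp add: pres_gen_def carrier_presented_group)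

lemma pres_gen_pow:
  "pres_gen R x [^]\<^bsub>presented_group R\<^esub> n = word_class R (replicate n (x, True))" for n :: nat
  by (induction n)
    (simp_all add: nat_pow_def one_presented_group pres_gen_def replicate_append_same)

primrec word_val :: "('k, 'm) monoid_scheme \<Rightarrow> ('g \<Rightarrow> 'k) \<Rightarrow> 'g word \<Rightarrow> 'k" where
  "word_val K f [] = \<one>\<^bsub>K\<^esub>"
| "word_val K f (l # u) =
    (if snd l then f (fst l) else inv\<^bsub>K\<^esub> f (fst l)) \<otimes>\<^bsub>K\<^esub> word_val K f u"

context group
begin

lemma word_val_closed: "range f \<subseteq> carrier G \<Longrightarrow> word_val G f u \<in> carrier G"
  by (induction u) (auto simp: image_subset_iff)

lemma word_val_append:
  assumes "range f \<subseteq> carrier G"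
  shows "word_val G f (u @ v) = word_val G f u \<otimes> word_val G f v"
  using assms
  by (induction u) (auto simp: word_val_closed m_assoc image_subset_iff)

lemma word_val_pres_eq:
  assumes f: "range f \<subseteq> carrier G" and R: "\<And>r. r \<in> R \<Longrightarrow> word_val G f r = \<one>"
    and "pres_eq R u v"
  shows "word_val G f u = word_val G f v"
  using assms(3)
proof (induction rule: pres_eq.induct)
  case (cancel u x b v)
  have "f x \<in> carrier G" using f by auto
  then have "word_val G f [(x, b), (x, \<not> b)] = \<one>"
    by simp
  then show ?case
    using f by (simp only: word_val_append word_val_closed l_one)
next
  case (relator r u v)
  then show ?case
    using f by (simp only: word_val_append word_val_closed l_one R)
qed simp_all

text \<open>Universal property of a presentation (von Dyck).\<close>

lemma presented_group_hom_exists: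
  assumes f: "range f \<subseteq> carrier G" and R: "\<And>r. r \<in> R \<Longrightarrow> word_val G f r = \<one>"
  obtains h where "h \<in> hom (presented_group R) G"
    and "\<And>u. h (word_class R u) = word_val G f u" and "\<And>x. h (pres_gen R x) = f x"
proof -
  define h where "h X = word_val G f (SOME u. X = word_class R u)" for X
  have h: "h (word_class R u) = word_val G f u" for u
  proof -
    have "word_class R u = word_class R (SOME v. word_class R u = word_class R v)"
      by (rule someI_ex) blast
    then show ?thesis
      unfolding h_def
      by (metis word_class_eq_iff word_val_pres_eq[OF f R])
  qed
  have "h \<in> hom (presented_group R) G"
    by (rule homI) (auto simp: carrier_presented_group h word_val_closed[OF f] word_val_append[OF f])
  moreover have "h (pres_gen R x) = f x" for x
  proof -
    have "f x \<in> carrier G" using f by auto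
    then show ?thesis by (simp add: pres_gen_def h)
  qed
  ultimately show ?thesis using that h by blast
qed

end

lemma presented_group_hom_unique:
  assumes "group K" "h \<in> hom (presented_group R) K" "h' \<in> hom (presented_group R) K"
    and gen: "\<And>x. h (pres_gen R x) = h' (pres_gen R x)"
    and "X \<in> carrier (presented_group R)"
  shows "h X = h' X"
proof -
  interpret K: group K by fact
  interpret P: group "presented_group R" by (rule group_presented_group)
  interpret h: group_hom "presented_group R" K h by unfold_locales fact
  interpret h': group_hom "presented_group R" K h' by unfold_locales fact
  have letter: "h (word_class R [l]) = h' (word_class R [l])" for l
  proof (cases l)
    case (Pair x b)
    show ?thesis
    proof (cases b)
      case True
      then show ?thesis using gen Pair by (simp add: pres_gen_def)
    next
      case False
      have "pres_eq R ([] @ [(x, False), (x, \<not> False)] @ []) ([] @ [])"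
        by (rule pres_eq.cancel)
      then have "word_class R [l] \<otimes>\<^bsub>presented_group R\<^esub> pres_gen R x = \<one>\<^bsub>presented_group R\<^esub>"
        using Pair False by (simp add: pres_gen_def one_presented_group word_class_eq_iff)
      then have "word_class R [l] = inv\<^bsub>presented_group R\<^esub> pres_gen R x"
        by (intro P.inv_equality[symmetric]) (simp_all, simp add: carrier_presented_group)
      then show ?thesis using gen by simp
    qed
  qed
  have "h (word_class R u) = h' (word_class R u)" for u
  proof (induction u)
    case Nil
    show ?case by (simp flip: one_presented_group)
  next
    case (Cons l u)
    have "word_class R (l # u) = word_class R [l] \<otimes>\<^bsub>presented_group R\<^esub> word_class R u"
      by simp
    then show ?case
      using Cons letter by (simp add: carrier_presented_group del: mult_word_class)
  qed
  with assms(5) show ?thesis by (auto simp: carrier_presented_group)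
qed

section \<open>The free product of two cyclic groups\<close>

datatype two_gens = Alpha | Beta

definition cyclic_relators :: "nat \<Rightarrow> nat \<Rightarrow> two_gens word set" where
  "cyclic_relators p q = {replicate p (Alpha, True), replicate q (Beta, True)}"

definition cyclic_free_product :: "nat \<Rightarrow> nat \<Rightarrow> two_gens word set monoid" where
  "cyclic_free_product p q = presented_group (cyclic_relators p q)"

definition gen_alpha :: "nat \<Rightarrow> nat \<Rightarrow> two_gens word set" where
  "gen_alpha p q = pres_gen (cyclic_relators p q) Alpha"

definition gen_beta :: "nat \<Rightarrow> nat \<Rightarrow> two_gens word set" where
  "gen_beta p q = pres_gen (cyclic_relators p q) Beta"

lemma (in group) word_val_replicate:
  assumes "range f \<subseteq> carrier G"
  shows "word_val G f (replicate n (x, True)) = f x [^] n"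
proof -
  have "f x \<in> carrier G" using assms by auto
  then show ?thesis
    by (induction n) (simp_all only: replicate.simps word_val.simps nat_pow_0 nat_pow_Suc2 fst_conv snd_conv if_True)
qed

lemma gen_alpha_pow: "gen_alpha p q [^]\<^bsub>cyclic_free_product p q\<^esub> p = \<one>\<^bsub>cyclic_free_product p q\<^esub>"
  using pres_eq.relator[of "replicate p (Alpha, True)" "cyclic_relators p q" "[]" "[]"]
  by (simp add: gen_alpha_def cyclic_free_product_def pres_gen_pow one_presented_group
      word_class_eq_iff cyclic_relators_def)

lemma gen_beta_pow: "gen_beta p q [^]\<^bsub>cyclic_free_product p q\<^esub> q = \<one>\<^bsub>cyclic_free_product p q\<^esub>"
  using pres_eq.relator[of "replicate q (Beta, True)" "cyclic_relators p q" "[]" "[]"]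
  by (simp add: gen_beta_def cyclic_free_product_def pres_gen_pow one_presented_group
      word_class_eq_iff cyclic_relators_def)

lemma cyclic_free_product_hom_exists:
  assumes "group K" "a \<in> carrier K" "b \<in> carrier K"
    and "a [^]\<^bsub>K\<^esub> p = \<one>\<^bsub>K\<^esub>" "b [^]\<^bsub>K\<^esub> q = \<one>\<^bsub>K\<^esub>"
  shows "\<exists>h\<in>hom (cyclic_free_product p q) K. h (gen_alpha p q) = a \<and> h (gen_beta p q) = b"
proof -
  interpret K: group K by fact
  define f where "f x = (case x of Alpha \<Rightarrow> a | Beta \<Rightarrow> b)" for x
  have f: "range f \<subseteq> carrier K"
    using assms by (auto simp: f_def split: two_gens.splits)
  have "word_val K f r = \<one>\<^bsub>K\<^esub>" if "r \<in> cyclic_relators p q" for r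
    using that assms by (auto simp: cyclic_relators_def K.word_val_replicate[OF f] f_def)
  from K.presented_group_hom_exists[OF f this] obtain h
    where "h \<in> hom (presented_group (cyclic_relators p q)) K"
      "\<And>x. h (pres_gen (cyclic_relators p q) x) = f x" by metis
  then show ?thesis
    by (auto simp: cyclic_free_product_def gen_alpha_def gen_beta_def f_def intro!: bexI[of _ h])
qed

text \<open>
  The presentation is the free product (coproduct) of \<open>integer_mod_group p\<close> and
  \<open>integer_mod_group q\<close>, with \<open>gen_alpha\<close> and \<open>gen_beta\<close> the images of the two generators \<open>1\<close>.
\<close>

lemma cyclic_free_product_embeddings:
  shows "(\<lambda>k. gen_alpha p q [^]\<^bsub>cyclic_free_product p q\<^esub> k)
           \<in> hom (integer_mod_group p) (cyclic_free_product p q)" (is ?A)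
    and "(\<lambda>k. gen_beta p q [^]\<^bsub>cyclic_free_product p q\<^esub> k)
           \<in> hom (integer_mod_group q) (cyclic_free_product p q)" (is ?B)
proof -
  interpret P: group "cyclic_free_product p q"
    unfolding cyclic_free_product_def by (rule group_presented_group)
  have *: "(\<lambda>k. x [^]\<^bsub>cyclic_free_product p q\<^esub> k) \<in> hom (integer_mod_group n) (cyclic_free_product p q)"
    if "x \<in> carrier (cyclic_free_product p q)"
      and "x [^]\<^bsub>cyclic_free_product p q\<^esub> n = \<one>\<^bsub>cyclic_free_product p q\<^esub>" for x n
  proof (rule homI)
    fix i j
    have "x [^]\<^bsub>cyclic_free_product p q\<^esub> ((i + j) mod int n)
        = x [^]\<^bsub>cyclic_free_product p q\<^esub> (i + j)"
    proof -
      have "x [^]\<^bsub>cyclic_free_product p q\<^esub> (int n * ((i + j) div int n)) = \<one>\<^bsub>cyclic_free_product p q\<^esub>"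
        using that by (simp flip: P.int_pow_pow add: int_pow_int)
      then show ?thesis
        using that by (metis P.int_pow_closed P.int_pow_mult P.l_one mult_div_mod_eq)
    qed
    then show "x [^]\<^bsub>cyclic_free_product p q\<^esub> (i \<otimes>\<^bsub>integer_mod_group n\<^esub> j)
        = x [^]\<^bsub>cyclic_free_product p q\<^esub> i \<otimes>\<^bsub>cyclic_free_product p q\<^esub> x [^]\<^bsub>cyclic_free_product p q\<^esub> j"
      using that by (simp add: P.int_pow_mult)
  qed (use that in auto)
  show ?A by (rule *) (simp_all only: gen_alpha_pow, simp add: gen_alpha_def cyclic_free_product_def)
  show ?B by (rule *) (simp_all only: gen_beta_pow, simp add: gen_beta_def cyclic_free_product_def)
qed

lemma cyclic_free_product_coproduct:
  assumes "p \<ge> 2" "q \<ge> 2" "group K"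
    and f: "f \<in> hom (integer_mod_group p) K" and g: "g \<in> hom (integer_mod_group q) K"
  shows "\<exists>h\<in>hom (cyclic_free_product p q) K.
      (\<forall>k\<in>carrier (integer_mod_group p). h (gen_alpha p q [^]\<^bsub>cyclic_free_product p q\<^esub> k) = f k) \<and>
      (\<forall>k\<in>carrier (integer_mod_group q). h (gen_beta p q [^]\<^bsub>cyclic_free_product p q\<^esub> k) = g k) \<and>
      (\<forall>h'\<in>hom (cyclic_free_product p q) K.
        h' (gen_alpha p q) = f 1 \<and> h' (gen_beta p q) = g 1 \<longrightarrow>
        (\<forall>X\<in>carrier (cyclic_free_product p q). h' X = h X))"
proof -
  interpret K: group K by fact
  interpret P: group "cyclic_free_product p q"
    unfolding cyclic_free_product_def by (rule group_presented_group)
  have pow: "e k = e 1 [^]\<^bsub>K\<^esub> k" "e 1 \<in> carrier K" "e 1 [^]\<^bsub>K\<^esub> n = \<one>\<^bsub>K\<^esub>"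
    if e: "e \<in> hom (integer_mod_group n) K" and "n \<ge> 2" and k: "k \<in> carrier (integer_mod_group n)" for e n k
  proof -
    interpret e: group_hom "integer_mod_group n" K e
      by (simp add: group_hom_def group_hom_axioms_def e K.is_group)
    have 1: "1 \<in> carrier (integer_mod_group n)"
      using \<open>n \<ge> 2\<close> by (simp add: carrier_integer_mod_group)
    show "e 1 \<in> carrier K" using 1 by simp
    have E: "e (j mod int n) = e 1 [^]\<^bsub>K\<^esub> j" for j
      using e.hom_int_pow[OF 1, of j] \<open>n \<ge> 2\<close> by (simp add: int_pow_integer_mod_group)
    show "e k = e 1 [^]\<^bsub>K\<^esub> k"
      using E[of k] k \<open>n \<ge> 2\<close> by (simp add: carrier_integer_mod_group)
    show "e 1 [^]\<^bsub>K\<^esub> n = \<one>\<^bsub>K\<^esub>"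
      using E[of "int n"] e.hom_one by (simp add: int_pow_int)
  qed
  have zero: "0 \<in> carrier (integer_mod_group n)" for n
    by (simp add: carrier_integer_mod_group)
  note pf = pow[OF f \<open>p \<ge> 2\<close>] and pg = pow[OF g \<open>q \<ge> 2\<close>]
  obtain h where h: "h \<in> hom (cyclic_free_product p q) K"
      and ha: "h (gen_alpha p q) = f 1" and hb: "h (gen_beta p q) = g 1"
    using cyclic_free_product_hom_exists[OF \<open>group K\<close> pf(2)[OF zero] pg(2)[OF zero] pf(3)[OF zero] pg(3)[OF zero]]
    by blast
  interpret h: group_hom "cyclic_free_product p q" K h
    by unfold_locales fact
  have c: "gen_alpha p q \<in> carrier (cyclic_free_product p q)" "gen_beta p q \<in> carrier (cyclic_free_product p q)"
    by (simp_all add: gen_alpha_def gen_beta_def cyclic_free_product_def)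
  show ?thesis
  proof (rule bexI[OF _ h], intro conjI ballI impI)
    fix k assume "k \<in> carrier (integer_mod_group p)"
    then show "h (gen_alpha p q [^]\<^bsub>cyclic_free_product p q\<^esub> k) = f k"
      using pf(1) ha c by (simp add: h.hom_int_pow)
  next
    fix k assume "k \<in> carrier (integer_mod_group q)"
    then show "h (gen_beta p q [^]\<^bsub>cyclic_free_product p q\<^esub> k) = g k"
      using pg(1) hb c by (simp add: h.hom_int_pow)
  next
    fix h' X
    assume h': "h' \<in> hom (cyclic_free_product p q) K" "h' (gen_alpha p q) = f 1 \<and> h' (gen_beta p q) = g 1"
      and X: "X \<in> carrier (cyclic_free_product p q)"
    have "h' (pres_gen (cyclic_relators p q) x) = h (pres_gen (cyclic_relators p q) x)" for x
      using h' ha hb by (cases x) (simp_all add: gen_alpha_def gen_beta_def)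
    then show "h' X = h X"
      using presented_group_hom_unique[OF \<open>group K\<close>] h h'(1) X
      unfolding cyclic_free_product_def by blast
  qed
qed

section \<open>Rotations\<close>

text \<open>Matrices act on column vectors; coordinates 1, 2, 3 are \<open>x\<close>, \<open>y\<close>, \<open>z\<close>.\<close>

definition rot_x :: "real \<Rightarrow> real^3^3" where
  "rot_x t = vector [vector [1, 0, 0],
                     vector [0, cos t, - sin t],
                     vector [0, sin t, cos t]]"

definition rot_z :: "real \<Rightarrow> real^3^3" where
  "rot_z t = vector [vector [cos t, - sin t, 0],
                     vector [sin t, cos t, 0],
                     vector [0, 0, 1]]"

definition SO3 :: "(real^3^3) monoid" where
  "SO3 = \<lparr>carrier = {M. rotation_matrix M}, monoid.mult = (**), one = mat 1\<rparr>"

definition rot_group :: "nat \<Rightarrow> nat \<Rightarrow> (real^3^3) monoid" where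
  "rot_group p q = subgroup_generated SO3 {rot_x (2 * pi / real p), rot_z (2 * pi / real q)}"

lemma group_SO3: "group SO3"
proof (rule groupI)
  fix M assume "M \<in> carrier SO3"
  then have "transpose M \<in> carrier SO3" "transpose M \<otimes>\<^bsub>SO3\<^esub> M = \<one>\<^bsub>SO3\<^esub>"
    by (auto simp: SO3_def rotation_matrix_def orthogonal_matrix_def)
  then show "\<exists>N\<in>carrier SO3. N \<otimes>\<^bsub>SO3\<^esub> M = \<one>\<^bsub>SO3\<^esub>" by blast
qed (auto simp: SO3_def rotation_matrix_def det_mul orthogonal_matrix_id
    matrix_mul_assoc intro: orthogonal_matrix_mul)

lemma rot_x_in_SO3: "rot_x t \<in> carrier SO3"
  using sin_cos_squared_add[of t]
  by (simp add: SO3_def rotation_matrix_def orthogonal_matrix rot_x_def det_3 vec_eq_iff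
      forall_3 matrix_matrix_mult_def transpose_def mat_def sum_3 power2_eq_square add.commute)

lemma rot_z_in_SO3: "rot_z t \<in> carrier SO3"
  using sin_cos_squared_add[of t]
  by (simp add: SO3_def rotation_matrix_def orthogonal_matrix rot_z_def det_3 vec_eq_iff
      forall_3 matrix_matrix_mult_def transpose_def mat_def sum_3 power2_eq_square add.commute)

lemma carrier_rot_group:
  "carrier (rot_group p q) = generate SO3 {rot_x (2 * pi / real p), rot_z (2 * pi / real q)}"
  by (simp add: rot_group_def carrier_subgroup_generated rot_x_in_SO3 rot_z_in_SO3 Int_absorb1)

end

theory Submission
  imports Defs
begin

text \<open>
  In the lift of rotations to \<open>2 \<times> 2\<close> complex matrices modulo scalars, the rotation by \<open>\<theta>\<close> about the
  \<open>z\<close>-axis is \<open>diag(w, 1)\<close> and twice the one about the \<open>x\<close>-axis is \<open>((w + 1, w - 1), (w - 1, w + 1))\<close>,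
  where \<open>w = exp(- i \<theta>)\<close>.  For odd \<open>p\<close> and \<open>q\<close> all entries lie in the ring generated by the roots of
  unity of odd order \<open>n = p q\<close>, where \<open>w - 1\<close> and \<open>w + 1\<close> are congruent and invertible modulo \<open>2\<close> for
  \<open>w \<noteq> 1\<close>.  So, modulo \<open>2\<close>, a rotation about \<open>x\<close> maps
  \<open>(0, 1)\<close> and all vectors \<open>(z t, t)\<close> with \<open>t\<close> invertible and \<open>z \<noteq> 1\<close> a root of unity to vectors \<open>(t', t')\<close> with
  \<open>t'\<close> invertible, which a rotation about \<open>z\<close> maps back to the form \<open>(z t', t')\<close>.  Hence an alternating word
  that contains \<open>A\<close> does not map \<open>(0, 1)\<close> to a multiple of itself.  If \<open>p\<close> is even, then
  \<open>A^(p/2)\<close> is a half turn and inverts \<open>B\<close>, a relation that fails in the quotient \<open>\<int>/q\<close> of the free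
  product; likewise for \<open>q\<close>.
\<close>

section \<open>Roots of unity of odd order modulo 2\<close>

text \<open>Modulo 2 the coefficient matrix is the identity, so its determinant is odd and thus
  nonzero. The induction replaces determinants by Gaussian elimination, one unknown at a
  time.\<close>

lemma odd_diagonal_system_trivial:
  fixes v :: "'a \<Rightarrow> 'b :: {idom, ring_char_0}" and c :: "'a \<Rightarrow> 'a \<Rightarrow> int"
  assumes "finite X"
    and "\<And>i. i \<in> X \<Longrightarrow> odd (d i)"
    and "\<And>i. i \<in> X \<Longrightarrow> of_int (d i) * v i = 2 * (\<Sum>j\<in>X. of_int (c i j) * v j)"
    and "i \<in> X"
  shows "v i = 0"
  using assms
proof (induction X arbitrary: d c i rule: finite_induct)
  case empty
  then show ?case by simp
next
  case (insert k X)
  \<comment> \<open>The diagonal term of row \<open>k\<close> is moved to the left; the resulting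
    pivot \<open>e\<close> is still odd.\<close>
  define e where "e = d k - 2 * c k k"
  have "odd e" using insert.prems(1)[of k] by (simp add: e_def)
  have k: "of_int e * v k = 2 * (\<Sum>j\<in>X. of_int (c k j) * v j)"
    using insert.prems(2)[of k] insert.hyps by (simp add: e_def algebra_simps)
  \<comment> \<open>Substituting row \<open>k\<close> into \<open>e\<close> times row
    \<open>i\<close> eliminates \<open>v k\<close> without division and keeps the shape: odd
    multiple on the left, even combination on the right.\<close>
  have X: "v j = 0" if "j \<in> X" for j
  proof (rule insert.IH[where d = "\<lambda>i. e * d i" and c = "\<lambda>i j. e * c i j + 2 * c i k * c k j"])
    fix i assume "i \<in> X"
    show "odd (e * d i)" using \<open>odd e\<close> \<open>i \<in> X\<close> insert.prems(1)[of i] by simp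
    have "of_int (d i) * v i = 2 * (of_int (c i k) * v k + (\<Sum>j\<in>X. of_int (c i j) * v j))"
      using insert.prems(2)[of i] \<open>i \<in> X\<close> insert.hyps by simp
    then have "of_int (e * d i) * v i
        = 2 * (of_int e * (of_int (c i k) * v k + (\<Sum>j\<in>X. of_int (c i j) * v j)))"
      by simp
    also have "\<dots> = 2 * (of_int (c i k) * (of_int e * v k) + of_int e * (\<Sum>j\<in>X. of_int (c i j) * v j))"
      by (simp add: algebra_simps)
    also have "\<dots> = 2 * (\<Sum>j\<in>X. of_int (e * c i j + 2 * c i k * c k j) * v j)"
      unfolding k by (simp add: sum_distrib_left sum.distrib algebra_simps)
    finally show "of_int (e * d i) * v i
        = 2 * (\<Sum>j\<in>X. of_int (e * c i j + 2 * c i k * c k j) * v j)" .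
  qed (use that in auto)
  have "of_int e * v k = 0" using k X by simp
  moreover have "e \<noteq> 0" using \<open>odd e\<close> by auto
  ultimately show ?case using X insert.prems(3) by auto
qed

text \<open>At a nontrivial root of unity with \<open>x ^ m = 1\<close> the geometric sum vanishes,
  and \<open>x - 1\<close> is seen to divide \<open>m\<close>.\<close>

lemma sum_mult_power_telescope:
  fixes x :: "'a :: comm_ring_1"
  shows "(x - 1) * (\<Sum>k<m. of_nat k * x ^ k) = of_nat m * x ^ m - x * (\<Sum>k<m. x ^ k)"
  by (induction m) (simp_all add: algebra_simps)

text \<open>The ring Z[zeta] for a primitive \<open>n\<close>-th root zeta. Spanning by all roots,
  although they are linearly dependent, makes multiplication by a root a mere permutation of
  coefficients.\<close>

definition cyclotomic_ints :: "nat \<Rightarrow> complex set" where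
  "cyclotomic_ints n = range (\<lambda>c. \<Sum>x | x ^ n = 1. of_int (c x) * x)"

text \<open>Elements whose class in Z[zeta]/2 is invertible, expressed by witnesses instead of a
  quotient ring.\<close>

definition units_mod_2 :: "nat \<Rightarrow> complex set" where
  "units_mod_2 n = {u \<in> cyclotomic_ints n.
     \<exists>v\<in>cyclotomic_ints n. \<exists>s\<in>cyclotomic_ints n. u * v = 1 + 2 * s}"

context
  fixes n :: nat
  assumes "odd n"
begin

lemma n_pos: "n > 0" using \<open>odd n\<close> by (simp add: odd_pos)

lemma finite_roots: "finite {x :: complex. x ^ n = 1}"
  using n_pos by (intro finite_roots_unity) simp

lemma cyclotomic_ints_cmult: "s \<in> cyclotomic_ints n \<Longrightarrow> of_int k * s \<in> cyclotomic_ints n"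
  unfolding cyclotomic_ints_def
  by (auto simp: sum_distrib_left mult.assoc intro!: image_eqI[of _ _ "\<lambda>x. k * _ x"])

lemma cyclotomic_ints_add:
  "s \<in> cyclotomic_ints n \<Longrightarrow> t \<in> cyclotomic_ints n \<Longrightarrow> s + t \<in> cyclotomic_ints n"
  unfolding cyclotomic_ints_def
  by (auto simp: sum.distrib ring_distribs intro!: image_eqI[of _ _ "\<lambda>x. _ x + _ x"])

lemma cyclotomic_ints_minus: "s \<in> cyclotomic_ints n \<Longrightarrow> - s \<in> cyclotomic_ints n"
  using cyclotomic_ints_cmult[of s "-1"] by simp

lemma cyclotomic_ints_diff:
  "s \<in> cyclotomic_ints n \<Longrightarrow> t \<in> cyclotomic_ints n \<Longrightarrow> s - t \<in> cyclotomic_ints n"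
  using cyclotomic_ints_add[of s "- t"] cyclotomic_ints_minus[of t] by simp

lemma root_in_cyclotomic_ints: "x ^ n = 1 \<Longrightarrow> x \<in> cyclotomic_ints n"
  unfolding cyclotomic_ints_def
  by (rule image_eqI[of _ _ "\<lambda>y. if y = x then 1 else 0"])
    (simp_all add: sum.If_cases if_distrib[of of_int] if_distrib[of "\<lambda>a. a * _"] finite_roots
      cong: if_cong)

lemma of_int_in_cyclotomic_ints: "of_int k \<in> cyclotomic_ints n"
  using cyclotomic_ints_cmult[OF root_in_cyclotomic_ints[of 1], of k] by simp

lemma cyclotomic_ints_sum:
  "(\<And>i. i \<in> I \<Longrightarrow> f i \<in> cyclotomic_ints n) \<Longrightarrow> sum f I \<in> cyclotomic_ints n"
  using of_int_in_cyclotomic_ints[of 0]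
  by (induction I rule: infinite_finite_induct) (auto intro: cyclotomic_ints_add)

text \<open>Multiplication by \<open>x\<close> permutes the roots. This gives both closure under
  products and the rows of the linear system below.\<close>

lemma cyclotomic_ints_mult_root_expansion:
  fixes x :: complex
  assumes "x ^ n = 1"
  shows "(\<Sum>y | y ^ n = 1. of_int (c y) * y) * x = (\<Sum>y | y ^ n = 1. of_int (c (y / x)) * y)"
proof -
  have "x \<noteq> 0" using assms n_pos by (auto simp: power_0_left)
  have "(\<Sum>y | y ^ n = 1. of_int (c y) * y) * x = (\<Sum>y | y ^ n = 1. of_int (c y) * (y * x))"
    by (simp add: sum_distrib_right mult.assoc)
  also have "\<dots> = (\<Sum>y | y ^ n = 1. of_int (c (y / x)) * y)"
    using \<open>x \<noteq> 0\<close> assms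
    by (intro sum.reindex_bij_witness[of _ "\<lambda>y. y / x" "\<lambda>y. y * x"])
      (auto simp: power_mult_distrib power_divide)
  finally show ?thesis .
qed

lemma cyclotomic_ints_mult:
  assumes "s \<in> cyclotomic_ints n" "t \<in> cyclotomic_ints n"
  shows "s * t \<in> cyclotomic_ints n"
proof -
  obtain c where c: "t = (\<Sum>y | y ^ n = 1. of_int (c y) * y)"
    using assms(2) by (auto simp: cyclotomic_ints_def)
  have "s * x \<in> cyclotomic_ints n" if "x ^ n = 1" for x
    using assms(1) cyclotomic_ints_mult_root_expansion[OF that]
    by (auto simp: cyclotomic_ints_def)
  then have "(\<Sum>y | y ^ n = 1. of_int (c y) * (s * y)) \<in> cyclotomic_ints n"
    by (auto intro!: cyclotomic_ints_sum cyclotomic_ints_cmult)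
  then show ?thesis
    by (simp add: c sum_distrib_left algebra_simps)
qed

lemma power_in_cyclotomic_ints: "x ^ n = 1 \<Longrightarrow> x ^ k \<in> cyclotomic_ints n"
  by (rule root_in_cyclotomic_ints) (metis mult.commute power_mult power_one)

text \<open>
  Multiplying \<open>1 = 2 (- s)\<close> by each root of unity gives a linear system with odd diagonal and even
  off-diagonal coefficients (hence odd determinant), solved by the roots of unity themselves.
\<close>

lemma odd_not_even_cyclotomic_int:
  assumes "s \<in> cyclotomic_ints n"
  shows "1 + 2 * s \<noteq> 0"
proof
  assume 0: "1 + 2 * s = 0"
  obtain c where c: "- s = (\<Sum>y | y ^ n = 1. of_int (c y) * y)"
    using cyclotomic_ints_minus[OF assms] by (auto simp: cyclotomic_ints_def)
  \<comment> \<open>The unknown with index 1 has the value 1, which the system forces to be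
    0.\<close>
  have "(1::complex) = 0"
  proof (rule odd_diagonal_system_trivial[where v = "\<lambda>x. x" and d = "\<lambda>_. 1"
        and c = "\<lambda>x y. c (y / x)" and X = "{x. x ^ n = 1}"])
    fix x :: complex assume "x \<in> {x. x ^ n = 1}"
    then have "(- s) * x = (\<Sum>y | y ^ n = 1. of_int (c (y / x)) * y)"
      using cyclotomic_ints_mult_root_expansion[of x c] c by simp
    moreover have "x = 2 * ((- s) * x)"
    proof -
      have "2 * (- s) = 1" using 0 by (simp add: algebra_simps add_eq_0_iff)
      then show ?thesis by (metis mult.assoc mult_1)
    qed
    ultimately show "of_int 1 * x = 2 * (\<Sum>y | y ^ n = 1. of_int (c (y / x)) * y)"
      by simp
  qed (auto simp: finite_roots)
  then show False by simp
qed

lemma zero_notin_units_mod_2: "0 \<notin> units_mod_2 n"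
  using odd_not_even_cyclotomic_int by (force simp: units_mod_2_def)

lemma units_mod_2_in_cyclotomic_ints: "u \<in> units_mod_2 n \<Longrightarrow> u \<in> cyclotomic_ints n"
  by (simp add: units_mod_2_def)

lemma units_mod_2_mult:
  assumes "u \<in> units_mod_2 n" "u' \<in> units_mod_2 n"
  shows "u * u' \<in> units_mod_2 n"
proof -
  obtain v s v' s' where *: "u \<in> cyclotomic_ints n" "u' \<in> cyclotomic_ints n"
      "v \<in> cyclotomic_ints n" "v' \<in> cyclotomic_ints n" "s \<in> cyclotomic_ints n" "s' \<in> cyclotomic_ints n"
      "u * v = 1 + 2 * s" "u' * v' = 1 + 2 * s'"
    using assms by (auto simp: units_mod_2_def)
  have "(u * u') * (v * v') = (u * v) * (u' * v')" by simp
  also have "\<dots> = 1 + 2 * (s + s' + of_int 2 * (s * s'))"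
    unfolding * by (simp add: algebra_simps)
  finally show ?thesis
    unfolding units_mod_2_def using *(1-6)
    by (blast intro: cyclotomic_ints_mult cyclotomic_ints_add cyclotomic_ints_cmult)
qed

text \<open>Invertibility depends only on the class modulo 2: the same inverse \<open>v\<close>
  serves.\<close>

lemma units_mod_2_cong:
  assumes "u \<in> units_mod_2 n" "t \<in> cyclotomic_ints n"
  shows "u + 2 * t \<in> units_mod_2 n"
proof -
  obtain v s where *: "u \<in> cyclotomic_ints n" "v \<in> cyclotomic_ints n" "s \<in> cyclotomic_ints n"
      "u * v = 1 + 2 * s"
    using assms by (auto simp: units_mod_2_def)
  have "(u + 2 * t) * v = 1 + 2 * (s + t * v)"
    using *(4) by (simp add: algebra_simps)
  moreover have "u + 2 * t \<in> cyclotomic_ints n"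
    using cyclotomic_ints_add[OF *(1) cyclotomic_ints_cmult[OF assms(2), of 2]] by simp
  ultimately show ?thesis
    unfolding units_mod_2_def using * assms(2)
    by (blast intro: cyclotomic_ints_mult cyclotomic_ints_add)
qed

lemma root_in_units_mod_2: "x ^ n = 1 \<Longrightarrow> x \<in> units_mod_2 n"
proof -
  assume x: "x ^ n = 1"
  have "x * x ^ (n - 1) = 1 + 2 * of_int 0"
    using x n_pos by (simp flip: power_Suc)
  then show ?thesis
    unfolding units_mod_2_def using x
    by (blast intro: root_in_cyclotomic_ints power_in_cyclotomic_ints of_int_in_cyclotomic_ints)
qed

text \<open>The telescoping sum exhibits \<open>x - 1\<close> as a divisor of the odd number \<open>n\<close>.\<close>

lemma root_minus_1_in_units_mod_2:
  assumes "x ^ n = 1" "x \<noteq> 1"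
  shows "x - 1 \<in> units_mod_2 n"
proof -
  have "(\<Sum>k<n. x ^ k) = 0"
    using assms by (simp add: sum_gp_strict)
  then have "(x - 1) * (\<Sum>k<n. of_nat k * x ^ k) = of_nat n"
    using assms(1) by (simp add: sum_mult_power_telescope)
  also have "\<dots> = 1 + 2 * of_int (int (n div 2))"
    using odd_two_times_div_two_succ[OF \<open>odd n\<close>]
    by (metis add.commute of_int_of_nat_eq of_nat_1 of_nat_add of_nat_mult of_nat_numeral)
  finally have "(x - 1) * (\<Sum>k<n. of_nat k * x ^ k) = 1 + 2 * of_int (int (n div 2))" .
  moreover have "(\<Sum>k<n. of_nat k * x ^ k) \<in> cyclotomic_ints n"
  proof (rule cyclotomic_ints_sum)
    show "of_nat k * x ^ k \<in> cyclotomic_ints n" for k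
      using cyclotomic_ints_cmult[OF power_in_cyclotomic_ints[OF assms(1)], of "int k" k] by simp
  qed
  moreover have "x - 1 \<in> cyclotomic_ints n"
    using assms(1) by (intro cyclotomic_ints_diff root_in_cyclotomic_ints) auto
  ultimately show ?thesis
    unfolding units_mod_2_def using of_int_in_cyclotomic_ints by blast
qed

lemma root_plus_1_in_units_mod_2:
  assumes "x ^ n = 1" "x \<noteq> 1"
  shows "x + 1 \<in> units_mod_2 n"
  using units_mod_2_cong[OF root_minus_1_in_units_mod_2[OF assms] of_int_in_cyclotomic_ints[of 1]]
  by (simp add: algebra_simps)

end

section \<open>Spin lifts of rotations\<close>

text \<open>The Hermitian matrix \<open>x \<sigma>\<^sub>x + y \<sigma>\<^sub>y + z \<sigma>\<^sub>z\<close> (Pauli matrices).\<close>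

definition pauli :: "real^3 \<Rightarrow> complex^2^2" where
  "pauli v = vector [vector [of_real (v$3), Complex (v$1) (- (v$2))],
                     vector [Complex (v$1) (v$2), - of_real (v$3)]]"

text \<open>Conjugation by \<open>U\<close>, written without an inverse so that scalar factors are
  harmless. Even 0 is a lift; the unit conditions on the columns exclude it later.\<close>

definition spin_lift :: "complex^2^2 \<Rightarrow> real^3^3 \<Rightarrow> bool" where
  "spin_lift U R \<longleftrightarrow> (\<forall>v. U ** pauli v = pauli (R *v v) ** U)"

text \<open>The usual SU(2) lift multiplied by \<open>2 * cis (- t / 2)\<close>, which removes half
  angles and denominators; \<open>spin_z\<close> is scaled by \<open>cis (- t / 2)\<close>.\<close>

definition spin_x :: "real \<Rightarrow> complex^2^2" where
  "spin_x t = vector [vector [cis (- t) + 1, cis (- t) - 1],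
                      vector [cis (- t) - 1, cis (- t) + 1]]"

definition spin_z :: "real \<Rightarrow> complex^2^2" where
  "spin_z t = vector [vector [cis (- t), 0], vector [0, 1]]"

lemma spin_lift_mult:
  assumes "spin_lift U R" "spin_lift V S"
  shows "spin_lift (U ** V) (R ** S)"
  using assms unfolding spin_lift_def
  by (metis matrix_mul_assoc matrix_vector_mul_assoc)

lemma spin_lift_rot_z: "spin_lift (spin_z t) (rot_z t)"
  by (simp add: spin_lift_def spin_z_def rot_z_def pauli_def vec_eq_iff forall_2 sum_2 sum_3
      matrix_matrix_mult_def matrix_vector_mult_def complex_eq_iff algebra_simps)
    (use sin_cos_squared_add[of t] in algebra)

lemma spin_lift_rot_x: "spin_lift (spin_x t) (rot_x t)"
  by (simp add: spin_lift_def spin_x_def rot_x_def pauli_def vec_eq_iff forall_2 sum_2 sum_3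
      matrix_matrix_mult_def matrix_vector_mult_def complex_eq_iff algebra_simps)
    (use sin_cos_squared_add[of t] in algebra)

text \<open>Such a \<open>U\<close> commutes with the third Pauli matrix, hence is diagonal.\<close>

lemma spin_lift_one_offdiag:
  assumes "spin_lift U (mat 1)"
  shows "U $ 1 $ 2 = 0"
  using assms[unfolded spin_lift_def, rule_format, of "vector [0, 0, 1]"]
  by (simp add: pauli_def vec_eq_iff forall_2 sum_2 matrix_matrix_mult_def
      flip: zero_complex.code)

lemma rot_x_add: "rot_x s ** rot_x t = rot_x (s + t)"
  by (simp add: rot_x_def vec_eq_iff forall_3 sum_3 matrix_matrix_mult_def cos_add sin_add algebra_simps)

lemma rot_z_add: "rot_z s ** rot_z t = rot_z (s + t)"
  by (simp add: rot_z_def vec_eq_iff forall_3 sum_3 matrix_matrix_mult_def cos_add sin_add algebra_simps)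

lemma rot_x_0: "rot_x 0 = mat 1"
  by (simp add: rot_x_def vec_eq_iff forall_3 mat_def)

lemma rot_z_0: "rot_z 0 = mat 1"
  by (simp add: rot_z_def vec_eq_iff forall_3 mat_def)

lemma rot_x_pow: "rot_x t [^]\<^bsub>SO3\<^esub> (n::nat) = rot_x (real n * t)"
  by (induction n) (simp_all add: nat_pow_def SO3_def rot_x_0 rot_x_add algebra_simps)

lemma rot_z_pow: "rot_z t [^]\<^bsub>SO3\<^esub> (n::nat) = rot_z (real n * t)"
  by (induction n) (simp_all add: nat_pow_def SO3_def rot_z_0 rot_z_add algebra_simps)

lemma rot_x_eq_one_iff: "rot_x t = mat 1 \<longleftrightarrow> cis (- t) = 1"
  by (auto simp: rot_x_def vec_eq_iff forall_3 mat_def complex_eq_iff)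

lemma rot_z_eq_one_iff: "rot_z t = mat 1 \<longleftrightarrow> cis (- t) = 1"
  by (auto simp: rot_z_def vec_eq_iff forall_3 mat_def complex_eq_iff)

text \<open>The half turn reverses the z-axis and so conjugates a rotation about it into its
  inverse; the relation is written as a word without inverses.\<close>

lemma rot_x_pi_inverts_rot_z: "rot_x pi ** (rot_z t ** (rot_x pi ** rot_z t)) = mat 1"
  using sin_cos_squared_add[of t]
  by (simp add: rot_x_def rot_z_def vec_eq_iff forall_3 sum_3 matrix_matrix_mult_def mat_def
      power2_eq_square algebra_simps)

lemma rot_z_pi_inverts_rot_x: "rot_z pi ** (rot_x t ** (rot_z pi ** rot_x t)) = mat 1"
  using sin_cos_squared_add[of t]
  by (simp add: rot_x_def rot_z_def vec_eq_iff forall_3 sum_3 matrix_matrix_mult_def mat_def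
      power2_eq_square algebra_simps)

section \<open>Alternating words\<close>

text \<open>Reduced words containing \<open>a\<close>, sorted by their leading letter. The final
  power of \<open>b\<close> may be trivial (\<open>j = 0\<close>), since it fixes the line of (0, 1)
  anyway.\<close>

inductive_set alternating_a and alternating_b
  for G :: "('a, 'm) monoid_scheme" (structure) and a b and p q :: nat where
  base: "0 < i \<Longrightarrow> i < p \<Longrightarrow> j < q \<Longrightarrow> a [^] i \<otimes> b [^] j \<in> alternating_a G a b p q"
| step_a: "0 < i \<Longrightarrow> i < p \<Longrightarrow> y \<in> alternating_b G a b p q \<Longrightarrow> a [^] i \<otimes> y \<in> alternating_a G a b p q"
| step_b: "0 < j \<Longrightarrow> j < q \<Longrightarrow> y \<in> alternating_a G a b p q \<Longrightarrow> b [^] j \<otimes> y \<in> alternating_b G a b p q"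

context group
begin

lemma alternating_closed:
  assumes "a \<in> carrier G" "b \<in> carrier G"
  shows "y \<in> alternating_a G a b p q \<Longrightarrow> y \<in> carrier G"
    and "y \<in> alternating_b G a b p q \<Longrightarrow> y \<in> carrier G"
  by (induction rule: alternating_a_alternating_b.inducts) (use assms in auto)

definition alternating_words where
  "alternating_words a b p q =
    {b [^] j | j::nat. j < q} \<union> alternating_a G a b p q \<union> alternating_b G a b p q"

text \<open>Only the leading syllable is affected: a new one is created, its exponent grows by one,
  or it reaches the order of the generator and disappears.\<close>

lemma gen_mult_alternating_words:
  fixes p q :: nat
  assumes a: "a \<in> carrier G" "a [^] p = \<one>" and b: "b \<in> carrier G" "b [^] q = \<one>"
    and p: "p > 1" and q: "q > 1"
    and g: "g \<in> alternating_words a b p q"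
  shows "a \<otimes> g \<in> alternating_words a b p q" and "b \<otimes> g \<in> alternating_words a b p q"
proof -
  note closed = alternating_closed[OF a(1) b(1)]
  have aS: "a \<otimes> (a [^] i \<otimes> y) = a [^] Suc i \<otimes> y" if "y \<in> carrier G" for i :: nat and y
    using a(1) that by (simp only: nat_pow_Suc2 nat_pow_closed m_assoc)
  have bS: "b \<otimes> (b [^] i \<otimes> y) = b [^] Suc i \<otimes> y" if "y \<in> carrier G" for i :: nat and y
    using b(1) that by (simp only: nat_pow_Suc2 nat_pow_closed m_assoc)
  consider (pow) j where "j < q" "g = b [^] j" | (a) "g \<in> alternating_a G a b p q"
    | (b) "g \<in> alternating_b G a b p q"
    using g by (auto simp: alternating_words_def)
  then have "a \<otimes> g \<in> alternating_words a b p q \<and> b \<otimes> g \<in> alternating_words a b p q"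
  proof cases
    case pow
    have 1: "a \<otimes> g \<in> alternating_words a b p q"
      using alternating_a_alternating_b.base[of 1 p j q G a b] pow p a
      by (simp add: alternating_words_def)
    have 2: "b \<otimes> g = b [^] Suc j"
      using b pow by (simp only: nat_pow_Suc2)
    have "b \<otimes> g \<in> alternating_words a b p q"
    proof (cases "Suc j = q")
      case True
      then have "b \<otimes> g = b [^] (0::nat)" using 2 b by simp
      moreover have "0 < q" using q by simp
      ultimately show ?thesis unfolding alternating_words_def by blast
    next
      case False
      then have "Suc j < q" using pow by simp
      then show ?thesis using 2 unfolding alternating_words_def by blast
    qed
    with 1 show ?thesis by blast
  next
    case a
    have "b \<otimes> g \<in> alternating_words a b p q"
      using alternating_a_alternating_b.step_b[of 1 q g G a b p] a q b
      by (simp add: alternating_words_def)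
    moreover have "a \<otimes> g \<in> alternating_words a b p q"
      using a
    proof (cases rule: alternating_a.cases)
      case (base i j)
      then have e: "a \<otimes> g = a [^] Suc i \<otimes> b [^] j" using aS assms by blast
      show ?thesis
      proof (cases "Suc i = p")
        case True
        then have "a \<otimes> g = b [^] j" using e assms by simp
        then show ?thesis using base unfolding alternating_words_def by blast
      next
        case False
        then have "a [^] Suc i \<otimes> b [^] j \<in> alternating_a G a b p q"
          using base by (intro alternating_a_alternating_b.base) simp_all
        then show ?thesis
          unfolding e alternating_words_def by blast
      qed
    next
      case (step_a i y)
      then have e: "a \<otimes> g = a [^] Suc i \<otimes> y" using aS closed by blast
      show ?thesis
      proof (cases "Suc i = p")
        case True
        then have "a \<otimes> g = y" using e assms closed step_a by simp
        then show ?thesis using step_a unfolding alternating_words_def by blast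
      next
        case False
        then have "a [^] Suc i \<otimes> y \<in> alternating_a G a b p q"
          using step_a by (intro alternating_a_alternating_b.step_a) simp_all
        then show ?thesis
          unfolding e alternating_words_def by blast
      qed
    qed
    ultimately show ?thesis by blast
  next
    case b
    have "a \<otimes> g \<in> alternating_words a b p q"
      using alternating_a_alternating_b.step_a[of 1 p g G a b q] a b p assms(1)
      by (simp add: alternating_words_def)
    moreover have "b \<otimes> g \<in> alternating_words a b p q"
      using b
    proof (cases rule: alternating_b.cases)
      case (step_b i y)
      then have e: "b \<otimes> g = b [^] Suc i \<otimes> y" using bS closed by blast
      show ?thesis
      proof (cases "Suc i = q")
        case True
        then have "b \<otimes> g = y" using e assms closed step_b by simp
        then show ?thesis using step_b unfolding alternating_words_def by blast
      next
        case False
        then have "b [^] Suc i \<otimes> y \<in> alternating_b G a b p q"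
          using step_b by (intro alternating_a_alternating_b.step_b) simp_all
        then show ?thesis
          unfolding e alternating_words_def by blast
      qed
    qed
    ultimately show ?thesis by blast
  qed
  then show "a \<otimes> g \<in> alternating_words a b p q" "b \<otimes> g \<in> alternating_words a b p q" by auto
qed

text \<open>The inverse is the power \<open>x [^] (k - 1)\<close>, so stability under
  \<open>x\<close> itself suffices.\<close>

lemma inv_mult_closed_of_finite_order:
  fixes k :: nat
  assumes "x \<in> carrier G" "x [^] k = \<one>" "k > 0" "M \<subseteq> carrier G"
    and M: "\<And>g. g \<in> M \<Longrightarrow> x \<otimes> g \<in> M" and "g \<in> M"
  shows "inv x \<otimes> g \<in> M"
proof -
  have "x [^] (k - 1) \<otimes> x = \<one>"
    using assms(2,3) by (metis Suc_diff_1 nat_pow_Suc)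
  then have "inv x = x [^] (k - 1)"
    using assms(1) by (intro inv_equality) auto
  moreover have "x [^] m \<otimes> g \<in> M" for m :: nat
  proof (induction m)
    case 0
    then show ?case using assms by auto
  next
    case (Suc m)
    have "x [^] Suc m \<otimes> g = x \<otimes> (x [^] m \<otimes> g)"
      using assms by (simp only: nat_pow_Suc2 nat_pow_closed m_assoc subsetD)
    with M[OF Suc] show ?case by simp
  qed
  ultimately show ?thesis by simp
qed

end

lemma presented_group_induct:
  assumes "X \<in> carrier (presented_group R)" "\<one>\<^bsub>presented_group R\<^esub> \<in> M"
    and "\<And>x g. g \<in> M \<Longrightarrow> pres_gen R x \<otimes>\<^bsub>presented_group R\<^esub> g \<in> M"
    and "\<And>x g. g \<in> M \<Longrightarrow> inv\<^bsub>presented_group R\<^esub> pres_gen R x \<otimes>\<^bsub>presented_group R\<^esub> g \<in> M"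
  shows "X \<in> M"
proof -
  interpret P: group "presented_group R" by (rule group_presented_group)
  have "word_class R [(x, False)] = inv\<^bsub>presented_group R\<^esub> pres_gen R x" for x
  proof (rule P.inv_equality[symmetric])
    show "word_class R [(x, False)] \<otimes>\<^bsub>presented_group R\<^esub> pres_gen R x = \<one>\<^bsub>presented_group R\<^esub>"
      using pres_eq.cancel[of R "[]" x False "[]"]
      by (simp add: pres_gen_def one_presented_group word_class_eq_iff)
  qed (auto simp: carrier_presented_group pres_gen_def)
  then have letter: "word_class R [l] \<otimes>\<^bsub>presented_group R\<^esub> g \<in> M" if "g \<in> M" for l g
    using assms(3,4) that by (cases l; cases "snd l") (auto simp: pres_gen_def)
  have "word_class R u \<in> M" for u
  proof (induction u)
    case Nil
    show ?case using assms(2) by (simp add: one_presented_group)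
  next
    case (Cons l u)
    then show ?case using letter[OF Cons, of l] by simp
  qed
  with assms(1) show ?thesis by (auto simp: carrier_presented_group)
qed

text \<open>Existence of normal forms: the set of alternating words contains 1 and is stable under
  the generators and their inverses.\<close>

lemma cyclic_free_product_alternating_words:
  assumes "p > 1" "q > 1" "X \<in> carrier (cyclic_free_product p q)"
  shows "X \<in> group.alternating_words (cyclic_free_product p q) (gen_alpha p q) (gen_beta p q) p q"
proof -
  interpret P: group "cyclic_free_product p q"
    unfolding cyclic_free_product_def by (rule group_presented_group)
  let ?M = "P.alternating_words (gen_alpha p q) (gen_beta p q) p q"
  have c: "gen_alpha p q \<in> carrier (cyclic_free_product p q)"
    "gen_beta p q \<in> carrier (cyclic_free_product p q)"
    by (simp_all add: gen_alpha_def gen_beta_def cyclic_free_product_def)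
  note step = P.gen_mult_alternating_words[OF c(1) gen_alpha_pow c(2) gen_beta_pow assms(1,2)]
  have sub: "?M \<subseteq> carrier (cyclic_free_product p q)"
    using c P.alternating_closed[OF c] by (auto simp: P.alternating_words_def)
  have gens: "pres_gen (cyclic_relators p q) x = (case x of Alpha \<Rightarrow> gen_alpha p q | Beta \<Rightarrow> gen_beta p q)" for x
    by (cases x) (simp_all add: gen_alpha_def gen_beta_def)
  have fold: "presented_group (cyclic_relators p q) = cyclic_free_product p q"
    by (simp add: cyclic_free_product_def)
  show ?thesis
  proof (rule presented_group_induct[of X "cyclic_relators p q", unfolded fold])
    show "X \<in> carrier (cyclic_free_product p q)" by fact
    have "gen_beta p q [^]\<^bsub>cyclic_free_product p q\<^esub> (0::nat) \<in> ?M"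
      using assms(2) unfolding P.alternating_words_def by (blast intro: less_trans[OF zero_less_one])
    then show "\<one>\<^bsub>cyclic_free_product p q\<^esub> \<in> ?M" by simp
    fix x g assume g: "g \<in> ?M"
    show "pres_gen (cyclic_relators p q) x \<otimes>\<^bsub>cyclic_free_product p q\<^esub> g \<in> ?M"
      using step[OF g] by (simp add: gens split: two_gens.split)
    have "inv\<^bsub>cyclic_free_product p q\<^esub> gen_alpha p q \<otimes>\<^bsub>cyclic_free_product p q\<^esub> g \<in> ?M"
      using assms by (intro P.inv_mult_closed_of_finite_order[OF c(1) gen_alpha_pow _ sub step(1) g]) auto
    moreover have "inv\<^bsub>cyclic_free_product p q\<^esub> gen_beta p q \<otimes>\<^bsub>cyclic_free_product p q\<^esub> g \<in> ?M"
      using assms by (intro P.inv_mult_closed_of_finite_order[OF c(2) gen_beta_pow _ sub step(2) g]) auto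
    ultimately show "inv\<^bsub>cyclic_free_product p q\<^esub> pres_gen (cyclic_relators p q) x \<otimes>\<^bsub>cyclic_free_product p q\<^esub> g \<in> ?M"
      by (simp add: gens split: two_gens.split)
  qed
qed

section \<open>The images of alternating words\<close>

text \<open>
  The second column of a lift is the image of \<open>(0, 1)\<close>.  In \<open>spin_col_a\<close> it is \<open>(t, t)\<close> and in
  \<open>spin_col_b\<close> it is \<open>(z t, t)\<close> modulo \<open>2\<close>, with \<open>t\<close> invertible modulo \<open>2\<close> and \<open>z\<close> a nontrivial
  root of unity.
\<close>

definition spin_col_a :: "nat \<Rightarrow> real^3^3 \<Rightarrow> bool" where
  "spin_col_a n R \<longleftrightarrow> (\<exists>U. spin_lift U R \<and> U $ 1 $ 2 \<in> units_mod_2 n \<and> U $ 2 $ 2 \<in> units_mod_2 n \<and>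
     (\<exists>s\<in>cyclotomic_ints n. U $ 1 $ 2 = U $ 2 $ 2 + 2 * s))"

definition spin_col_b :: "nat \<Rightarrow> real^3^3 \<Rightarrow> bool" where
  "spin_col_b n R \<longleftrightarrow> (\<exists>U. spin_lift U R \<and> U $ 1 $ 2 \<in> units_mod_2 n \<and> U $ 2 $ 2 \<in> units_mod_2 n \<and>
     (\<exists>z. z ^ n = 1 \<and> z \<noteq> 1 \<and> (\<exists>s\<in>cyclotomic_ints n. U $ 1 $ 2 = z * U $ 2 $ 2 + 2 * s)))"

text \<open>The rotation about z fixes (0, 1), so the column is that of \<open>spin_x t\<close>,
  whose entries \<open>w - 1\<close> and \<open>w + 1\<close> differ by 2.\<close>

lemma spin_col_a_base:
  assumes "odd n" and t: "cis (- t) ^ n = 1" "cis (- t) \<noteq> 1"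
  shows "spin_col_a n (rot_x t ** rot_z s)"
proof -
  let ?U = "spin_x t ** spin_z s"
  have "?U $ 1 $ 2 = cis (- t) - 1" "?U $ 2 $ 2 = cis (- t) + 1"
    by (simp_all add: spin_x_def spin_z_def matrix_matrix_mult_def sum_2)
  moreover have "spin_lift ?U (rot_x t ** rot_z s)"
    by (intro spin_lift_mult spin_lift_rot_x spin_lift_rot_z)
  moreover have "cis (- t) - 1 = cis (- t) + 1 + 2 * of_int (- 1)"
    by simp
  ultimately show ?thesis
    unfolding spin_col_a_def
    by (metis root_minus_1_in_units_mod_2[OF assms] root_plus_1_in_units_mod_2[OF assms]
        of_int_in_cyclotomic_ints[OF \<open>odd n\<close>])
qed

text \<open>For a column (x, y) with x congruent to \<open>z * y\<close>, both new entries are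
  congruent to \<open>(w + 1) * (z + 1) * y\<close>, a product of units modulo 2 because
  \<open>w\<close> and \<open>z\<close> are not 1.\<close>

lemma spin_col_a_step:
  assumes "odd n" and t: "cis (- t) ^ n = 1" "cis (- t) \<noteq> 1" and "spin_col_b n R"
  shows "spin_col_a n (rot_x t ** R)"
proof -
  note closed = cyclotomic_ints_diff[OF \<open>odd n\<close>] units_mod_2_in_cyclotomic_ints[OF \<open>odd n\<close>]
  obtain U z s where U: "spin_lift U R" "U $ 1 $ 2 \<in> units_mod_2 n" "U $ 2 $ 2 \<in> units_mod_2 n"
    and z: "z ^ n = 1" "z \<noteq> 1" and s: "s \<in> cyclotomic_ints n" "U $ 1 $ 2 = z * U $ 2 $ 2 + 2 * s"
    using assms(4) by (auto simp: spin_col_b_def)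
  let ?w = "cis (- t)" and ?x = "U $ 1 $ 2" and ?y = "U $ 2 $ 2" and ?V = "spin_x t ** U"
  note w = root_plus_1_in_units_mod_2[OF \<open>odd n\<close> t]
    and z' = root_plus_1_in_units_mod_2[OF \<open>odd n\<close> z]
  have V1: "?V $ 1 $ 2 = (?w + 1) * (z + 1) * ?y + 2 * ((?w + 1) * s - ?y)"
    unfolding spin_x_def matrix_matrix_mult_def
    by (simp add: sum_2 s(2) algebra_simps)
  have V2: "?V $ 2 $ 2 = ?V $ 1 $ 2 + 2 * (?y - ?x)"
    unfolding spin_x_def matrix_matrix_mult_def
    by (simp add: sum_2 algebra_simps)
  have 1: "?V $ 1 $ 2 \<in> units_mod_2 n"
    unfolding V1
    by (intro units_mod_2_cong units_mod_2_mult cyclotomic_ints_diff cyclotomic_ints_mult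
        w z' U(3) s(1) units_mod_2_in_cyclotomic_ints[OF \<open>odd n\<close>] \<open>odd n\<close>)
  have 2: "?V $ 2 $ 2 \<in> units_mod_2 n"
    unfolding V2 using 1 U(2,3)
    by (intro units_mod_2_cong closed \<open>odd n\<close>)
  have 3: "?V $ 1 $ 2 = ?V $ 2 $ 2 + 2 * (?x - ?y)"
    unfolding V2 by (simp add: algebra_simps)
  have "?x - ?y \<in> cyclotomic_ints n"
    using U(2,3) by (intro closed)
  with 1 2 3 spin_lift_mult[OF spin_lift_rot_x[of t] U(1)] show ?thesis
    unfolding spin_col_a_def by blast
qed

lemma spin_col_b_step:
  assumes "odd n" and t: "cis (- t) ^ n = 1" "cis (- t) \<noteq> 1" and "spin_col_a n R"
  shows "spin_col_b n (rot_z t ** R)"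
proof -
  obtain U s where U: "spin_lift U R" "U $ 1 $ 2 \<in> units_mod_2 n" "U $ 2 $ 2 \<in> units_mod_2 n"
    and s: "s \<in> cyclotomic_ints n" "U $ 1 $ 2 = U $ 2 $ 2 + 2 * s"
    using assms(4) by (auto simp: spin_col_a_def)
  let ?V = "spin_z t ** U"
  have V: "?V $ 1 $ 2 = cis (- t) * U $ 1 $ 2" "?V $ 2 $ 2 = U $ 2 $ 2"
    by (simp_all add: spin_z_def matrix_matrix_mult_def sum_2)
  have "?V $ 1 $ 2 = cis (- t) * ?V $ 2 $ 2 + 2 * (cis (- t) * s)"
    unfolding V s(2) by (simp add: algebra_simps)
  moreover have "cis (- t) * s \<in> cyclotomic_ints n"
    by (rule cyclotomic_ints_mult[OF \<open>odd n\<close> root_in_cyclotomic_ints[OF \<open>odd n\<close> t(1)] s(1)])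
  moreover have "?V $ 1 $ 2 \<in> units_mod_2 n"
    unfolding V
    by (rule units_mod_2_mult[OF \<open>odd n\<close> root_in_units_mod_2[OF \<open>odd n\<close> t(1)] U(2)])
  moreover have "?V $ 2 $ 2 \<in> units_mod_2 n"
    unfolding V by fact
  ultimately show ?thesis
    using spin_lift_mult[OF spin_lift_rot_z[of t] U(1)] t unfolding spin_col_b_def by blast
qed

text \<open>The upper right entry of the lift is a unit modulo 2, hence nonzero, whereas every lift
  of the identity is diagonal.\<close>

lemma spin_col_not_one:
  assumes "odd n" "spin_col_a n R \<or> spin_col_b n R"
  shows "R \<noteq> mat 1"
  using assms spin_lift_one_offdiag zero_notin_units_mod_2[OF \<open>odd n\<close>]
  unfolding spin_col_a_def spin_col_b_def by metis

section \<open>Rotation angles as roots of unity\<close>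

lemma cis_root_of_unity:
  assumes "0 < m" "m dvd n"
  shows "cis (- (real i * (2 * pi / real m))) ^ n = 1"
proof -
  obtain k where n: "n = m * k" using assms(2) by blast
  have "real n * - (real i * (2 * pi / real m)) = 2 * pi * of_int (- int (k * i))"
    using assms by (simp add: n field_simps)
  then have "cis (- (real i * (2 * pi / real m))) ^ n = cis (2 * pi * of_int (- int (k * i)))"
    by (metis Complex.DeMoivre)
  also have "\<dots> = 1"
    by (intro cis_multiple_2pi Ints_of_int)
  finally show ?thesis .
qed

lemma cis_root_of_unity_nontrivial:
  assumes "0 < i" "i < m"
  shows "cis (- (real i * (2 * pi / real m))) \<noteq> 1"
proof -
  have "0 < real i * (2 * pi / real m)" "real i * (2 * pi / real m) < 2 * pi"
    using assms by (simp_all add: field_simps)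
  moreover have "cos x \<noteq> 1" if "0 < x" "x < 2 * pi" for x
  proof
    assume "cos x = 1"
    then obtain l :: int where l: "x = of_int l * 2 * pi"
      by (auto simp: cos_one_2pi_int)
    then have "0 < l" "l < 1" using that by (auto simp: zero_less_mult_iff)
    then show False by simp
  qed
  ultimately show ?thesis
    by (metis cis.sel(1) cos_minus one_complex.sel(1))
qed

section \<open>The homomorphism from the free product onto the rotation group\<close>

lemma mult_SO3: "monoid.mult SO3 = (**)" and one_SO3: "\<one>\<^bsub>SO3\<^esub> = mat 1"
  by (simp_all add: SO3_def)

lemma mult_rot_group: "monoid.mult (rot_group p q) = (**)"
  and one_rot_group: "\<one>\<^bsub>rot_group p q\<^esub> = mat 1"
  by (simp_all add: rot_group_def subgroup_generated_def mult_SO3 one_SO3)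

lemma group_rot_group: "group (rot_group p q)"
  unfolding rot_group_def by (rule group.group_subgroup_generated[OF group_SO3])

lemma rot_group_pow: "x [^]\<^bsub>rot_group p q\<^esub> (n::nat) = x [^]\<^bsub>SO3\<^esub> n"
  by (simp add: rot_group_def pow_subgroup_generated)

lemma rot_group_gens:
  "rot_x (2 * pi / real p) \<in> carrier (rot_group p q)"
  "rot_z (2 * pi / real q) \<in> carrier (rot_group p q)"
  by (auto simp: carrier_rot_group intro: generate.incl)

lemma group_cyclic_free_product: "group (cyclic_free_product p q)"
  unfolding cyclic_free_product_def by (rule group_presented_group)

lemma gens_in_cyclic_free_product:
  "gen_alpha p q \<in> carrier (cyclic_free_product p q)"
  "gen_beta p q \<in> carrier (cyclic_free_product p q)"
  by (simp_all add: gen_alpha_def gen_beta_def cyclic_free_product_def)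

text \<open>Serves both directions: for a given isomorphism, and for the map obtained from the
  universal property.\<close>

locale rotation_hom =
  fixes p q :: nat and h
  assumes hom: "h \<in> hom (cyclic_free_product p q) (rot_group p q)"
    and alpha: "h (gen_alpha p q) = rot_x (2 * pi / real p)"
    and beta: "h (gen_beta p q) = rot_z (2 * pi / real q)"
begin

sublocale group_hom "cyclic_free_product p q" "rot_group p q" h
  by (intro group_hom.intro group_hom_axioms.intro group_cyclic_free_product group_rot_group hom)

lemma hom_alpha_pow:
  "h (gen_alpha p q [^]\<^bsub>cyclic_free_product p q\<^esub> i) = rot_x (real i * (2 * pi / real p))" for i :: nat
  using gens_in_cyclic_free_product
  by (simp add: hom_nat_pow alpha rot_group_pow rot_x_pow)

lemma hom_beta_pow:
  "h (gen_beta p q [^]\<^bsub>cyclic_free_product p q\<^esub> i) = rot_z (real i * (2 * pi / real q))" for i :: nat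
  using gens_in_cyclic_free_product
  by (simp add: hom_nat_pow beta rot_group_pow rot_z_pow)

text \<open>With \<open>n = p * q\<close>, the roots of unity belonging to both axes lie in one ring
  of odd order; the exponent bounds make them nontrivial.\<close>

lemma hom_alternating:
  assumes "odd p" "odd q"
  shows "y \<in> alternating_a (cyclic_free_product p q) (gen_alpha p q) (gen_beta p q) p q
      \<Longrightarrow> spin_col_a (p * q) (h y)" (is "_ \<in> alternating_a ?F ?a ?b _ _ \<Longrightarrow> _")
    and "y \<in> alternating_b (cyclic_free_product p q) (gen_alpha p q) (gen_beta p q) p q
      \<Longrightarrow> spin_col_b (p * q) (h y)"
proof (induction rule: alternating_a_alternating_b.inducts)
  case (base i j)
  have "h (?a [^]\<^bsub>?F\<^esub> i \<otimes>\<^bsub>?F\<^esub> ?b [^]\<^bsub>?F\<^esub> j)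
      = rot_x (real i * (2 * pi / real p)) ** rot_z (real j * (2 * pi / real q))"
    by (simp add: gens_in_cyclic_free_product mult_rot_group hom_alpha_pow hom_beta_pow)
  then show ?case
    using base assms by (simp only:) (intro spin_col_a_base cis_root_of_unity cis_root_of_unity_nontrivial; simp)
next
  case (step_a i y)
  have "h (?a [^]\<^bsub>?F\<^esub> i \<otimes>\<^bsub>?F\<^esub> y) = rot_x (real i * (2 * pi / real p)) ** h y"
    using G.alternating_closed(2)[OF gens_in_cyclic_free_product step_a(3)] by (simp add: gens_in_cyclic_free_product mult_rot_group hom_alpha_pow)
  then show ?case
    using step_a assms by (simp only:) (intro spin_col_a_step cis_root_of_unity cis_root_of_unity_nontrivial; simp)
next
  case (step_b j y)
  have "h (?b [^]\<^bsub>?F\<^esub> j \<otimes>\<^bsub>?F\<^esub> y) = rot_z (real j * (2 * pi / real q)) ** h y"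
    using G.alternating_closed(1)[OF gens_in_cyclic_free_product step_b(3)] by (simp add: gens_in_cyclic_free_product mult_rot_group hom_beta_pow)
  then show ?case
    using step_b assms by (simp only:) (intro spin_col_b_step cis_root_of_unity cis_root_of_unity_nontrivial; simp)
qed

text \<open>The column invariants exclude every word containing \<open>gen_alpha\<close>; a
  remaining power of \<open>gen_beta\<close> is settled by its angle.\<close>

lemma trivial_kernel:
  assumes "odd p" "odd q" "p > 1" "q > 1"
    and X: "X \<in> carrier (cyclic_free_product p q)" and 1: "h X = mat 1"
  shows "X = \<one>\<^bsub>cyclic_free_product p q\<^esub>"
proof -
  have "odd (p * q)" using assms by simp
  from spin_col_not_one[OF this] 1 hom_alternating[OF assms(1,2)]
    cyclic_free_product_alternating_words[OF assms(3,4) X]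
  obtain j where j: "j < q" "X = gen_beta p q [^]\<^bsub>cyclic_free_product p q\<^esub> j"
    unfolding G.alternating_words_def by blast
  have "j = 0"
  proof (rule ccontr)
    assume "j \<noteq> 0"
    then have "cis (- (real j * (2 * pi / real q))) \<noteq> 1"
      using cis_root_of_unity_nontrivial[of j q] j by simp
    with 1 j show False by (simp add: hom_beta_pow rot_z_eq_one_iff)
  qed
  with j show ?thesis by simp
qed

lemma surjective: "h ` carrier (cyclic_free_product p q) = carrier (rot_group p q)"
proof
  show "h ` carrier (cyclic_free_product p q) \<subseteq> carrier (rot_group p q)"
    by auto
  have "subgroup (h ` carrier (cyclic_free_product p q)) (rot_group p q)"
    by (rule img_is_subgroup)
  then have "generate (rot_group p q) (h ` {gen_alpha p q, gen_beta p q})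
      \<subseteq> h ` carrier (cyclic_free_product p q)"
    using gens_in_cyclic_free_product by (intro H.generate_subgroup_incl) auto
  \<comment> \<open>Generating inside the subgroup gives the same set as generating inside
    \<open>SO3\<close>.\<close>
  moreover have "generate (rot_group p q) {rot_x (2 * pi / real p), rot_z (2 * pi / real q)}
      = carrier (rot_group p q)"
    using group.subgroup_generated2[OF group_SO3, of "{rot_x (2 * pi / real p), rot_z (2 * pi / real q)}"]
    by (metis carrier_subgroup_generated inf.absorb2 empty_subsetI insert_subset rot_group_def rot_group_gens)
  ultimately show "carrier (rot_group p q) \<subseteq> h ` carrier (cyclic_free_product p q)"
    by (simp add: alpha beta)
qed

end

section \<open>Half turns for even orders, faithfulness for odd orders\<close>

theorem corollary1:
  fixes p q :: nat
  assumes "p \<ge> 3" "q \<ge> 3"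
  shows "(\<exists>\<phi> \<in> iso (cyclic_free_product p q) (rot_group p q).
            \<phi> (gen_alpha p q) = rot_x (2 * pi / real p) \<and>
            \<phi> (gen_beta p q) = rot_z (2 * pi / real q))
         \<longleftrightarrow> odd p \<and> odd q"
proof
  assume "\<exists>\<phi> \<in> iso (cyclic_free_product p q) (rot_group p q).
            \<phi> (gen_alpha p q) = rot_x (2 * pi / real p) \<and>
            \<phi> (gen_beta p q) = rot_z (2 * pi / real q)"
  then obtain \<phi> where \<phi>: "\<phi> \<in> iso (cyclic_free_product p q) (rot_group p q)"
    and gens: "\<phi> (gen_alpha p q) = rot_x (2 * pi / real p)" "\<phi> (gen_beta p q) = rot_z (2 * pi / real q)"
    by blast
  interpret rotation_hom p q \<phi>
    using \<phi> gens by unfold_locales (simp_all add: iso_def)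
  let ?F = "cyclic_free_product p q"
  let ?a = "gen_alpha p q" and ?b = "gen_beta p q"
  have inj: "inj_on \<phi> (carrier ?F)"
    using \<phi> by (simp add: iso_def bij_betw_def)
  have trivial: "x = \<one>\<^bsub>?F\<^esub>" if "x \<in> carrier ?F" "\<phi> x = mat 1" for x
    using inj that hom_one by (metis G.one_closed inj_onD one_rot_group)
  note [simp] = gens_in_cyclic_free_product
  show "odd p \<and> odd q"
  proof (intro conjI notI)
    assume "even p"
    \<comment> \<open>The candidate for a half turn: its image is the rotation by pi about
      x.\<close>
    define y where "y = ?a [^]\<^bsub>?F\<^esub> (p div 2)"
    have y: "y \<in> carrier ?F" by (simp add: y_def)
    have "real (p div 2) * (2 * pi / real p) = pi"
      using \<open>even p\<close> assms by (simp add: real_of_nat_div)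
    then have "\<phi> y = rot_x pi"
      unfolding y_def hom_alpha_pow by simp
    then have "y \<otimes>\<^bsub>?F\<^esub> (?b \<otimes>\<^bsub>?F\<^esub> (y \<otimes>\<^bsub>?F\<^esub> ?b)) = \<one>\<^bsub>?F\<^esub>"
      using y by (intro trivial) (simp_all add: hom_mult mult_rot_group beta rot_x_pi_inverts_rot_z)
    \<comment> \<open>Killing \<open>?a\<close> turns the relation into 1 + 1 = 0 modulo
      \<open>q\<close>, impossible for \<open>q \<ge> 3\<close>.\<close>
    moreover obtain g where "g \<in> hom ?F (integer_mod_group q)" and g: "g ?a = 0" "g ?b = 1"
      using cyclic_free_product_hom_exists[of "integer_mod_group q" 0 1 p q] assms by auto
    then interpret g: group_hom ?F "integer_mod_group q" g
      by (intro group_hom.intro group_hom_axioms.intro group_cyclic_free_product group_integer_mod_group)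
    have "g y = 0" by (simp add: y_def g.hom_nat_pow g)
    ultimately show False
      using y g.hom_mult[of y "?b \<otimes>\<^bsub>?F\<^esub> (y \<otimes>\<^bsub>?F\<^esub> ?b)"] g.hom_one assms g
      by (simp add: g.hom_mult)
  next
    assume "even q"
    define y where "y = ?b [^]\<^bsub>?F\<^esub> (q div 2)"
    have y: "y \<in> carrier ?F" by (simp add: y_def)
    have "real (q div 2) * (2 * pi / real q) = pi"
      using \<open>even q\<close> assms by (simp add: real_of_nat_div)
    then have "\<phi> y = rot_z pi"
      unfolding y_def hom_beta_pow by simp
    then have "y \<otimes>\<^bsub>?F\<^esub> (?a \<otimes>\<^bsub>?F\<^esub> (y \<otimes>\<^bsub>?F\<^esub> ?a)) = \<one>\<^bsub>?F\<^esub>"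
      using y by (intro trivial) (simp_all add: hom_mult mult_rot_group alpha rot_z_pi_inverts_rot_x)
    \<comment> \<open>Symmetrically, killing \<open>?b\<close> leaves 2 = 0 modulo \<open>p\<close>,
      against \<open>p \<ge> 3\<close>.\<close>
    moreover obtain g where "g \<in> hom ?F (integer_mod_group p)" and g: "g ?b = 0" "g ?a = 1"
      using cyclic_free_product_hom_exists[of "integer_mod_group p" 1 0 p q] assms by auto
    then interpret g: group_hom ?F "integer_mod_group p" g
      by (intro group_hom.intro group_hom_axioms.intro group_cyclic_free_product group_integer_mod_group)
    have "g y = 0" by (simp add: y_def g.hom_nat_pow g)
    ultimately show False
      using y g.hom_mult[of y "?a \<otimes>\<^bsub>?F\<^esub> (y \<otimes>\<^bsub>?F\<^esub> ?a)"] g.hom_one assms g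
      by (simp add: g.hom_mult)
  qed
next
  assume odd: "odd p \<and> odd q"
  have "rot_x (2 * pi / real p) [^]\<^bsub>rot_group p q\<^esub> p = \<one>\<^bsub>rot_group p q\<^esub>"
    using assms by (simp add: rot_group_pow rot_x_pow one_rot_group rot_x_eq_one_iff complex_eq_iff)
  moreover have "rot_z (2 * pi / real q) [^]\<^bsub>rot_group p q\<^esub> q = \<one>\<^bsub>rot_group p q\<^esub>"
    using assms by (simp add: rot_group_pow rot_z_pow one_rot_group rot_z_eq_one_iff complex_eq_iff)
  ultimately obtain h where h: "h \<in> hom (cyclic_free_product p q) (rot_group p q)"
    "h (gen_alpha p q) = rot_x (2 * pi / real p)" "h (gen_beta p q) = rot_z (2 * pi / real q)"
    using cyclic_free_product_hom_exists[OF group_rot_group rot_group_gens] by blast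
  interpret rotation_hom p q h
    by unfold_locales (fact h)+
  have "inj_on h (carrier (cyclic_free_product p q))"
    using trivial_kernel odd assms by (simp add: inj_on_one_iff one_rot_group)
  then have "h \<in> iso (cyclic_free_product p q) (rot_group p q)"
    using h(1) surjective by (simp add: iso_def bij_betw_def)
  with h show "\<exists>\<phi> \<in> iso (cyclic_free_product p q) (rot_group p q).
            \<phi> (gen_alpha p q) = rot_x (2 * pi / real p) \<and>
            \<phi> (gen_beta p q) = rot_z (2 * pi / real q)"
    by blast
qed

end
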